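(* Let $\mu:(0,\infty)\to\mathbb{R}$ be a fractional Laurent polynomial, $\sigma\neq0$, $T>0$, $c_{-1}>0$, $\hat\mu(x)=\mu(x)-c_{-1}x^{-1}$, and let $\mathcal{P}_h:(0,\infty)\to(0,\infty)$ be a map for each step size $h$. Given any initial value $Y_0=X_0>0$ and any step size $h=T/M\in(0,1]$ with $M\in\mathbb{N}$, the scheme $$Y_{n+1}=\mathcal{P}_h(Y_n)+c_{-1}hY_{n+1}^{-1}+\hat\mu(\mathcal{P}_h(Y_n))h+\sigma\Delta W_n$$ admits unique, positive numerical solutions $\{Y_n\}_{n\in\mathbb{N}}$; that is, there is exactly one sequence of positive numbers $Y_n$ starting from $Y_0$ satisfying the recursion.
   Context: $W$ is a standard Brownian motion, $t_n=nh$, $\Delta W_n=W_{t_{n+1}}-W_{t_n}$. A fractional Laurent polynomial is a function $q:(0,\infty)\to\mathbb{R}$ of the form $q(x)=\sum_{n=e_1}^{e_2}a_nx^{s_n}$ with integers $e_1\le e_2$, $a_n\in\mathbb{R}$ and pairwise distinct exponents $s_n\in\mathbb{R}$. $\mathbb{N}$ denotes the set of nonnegative integers. *)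

theory Defs
  imports "HOL-Probability.Probability"
begin

definition standard_brownian_motion :: "'a measure \<Rightarrow> (real \<Rightarrow> 'a \<Rightarrow> real) \<Rightarrow> bool" where
  "standard_brownian_motion M W \<longleftrightarrow>
     prob_space M \<and>
     (\<forall>t\<ge>0. W t \<in> borel_measurable M) \<and>
     (AE \<omega> in M. W 0 \<omega> = 0) \<and>
     (\<forall>(t :: nat \<Rightarrow> real) k. t 0 \<ge> 0 \<and> strict_mono t \<longrightarrow>
        prob_space.indep_vars M (\<lambda>_. borel) (\<lambda>i \<omega>. W (t (Suc i)) \<omega> - W (t i) \<omega>) {..<k}) \<and>
     (\<forall>s t. 0 \<le> s \<and> s < t \<longrightarrow>
        distributed M lborel (\<lambda>\<omega>. W t \<omega> - W s \<omega>) (\<lambda>x. ennreal (normal_density 0 (sqrt (t - s)) x))) \<and>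
     (AE \<omega> in M. continuous_on {0..} (\<lambda>t. W t \<omega>))"

text \<open>Functions on the open half-line are rendered as total functions on the reals of which only
  the values at positive arguments are constrained or used.\<close>

definition fractional_laurent_poly :: "(real \<Rightarrow> real) \<Rightarrow> bool" where
  "fractional_laurent_poly q \<longleftrightarrow>
     (\<exists>(e1::int) (e2::int) (a :: int \<Rightarrow> real) (s :: int \<Rightarrow> real).
        e1 \<le> e2 \<and> inj_on s {e1..e2} \<and> (\<forall>x>0. q x = (\<Sum>n=e1..e2. a n * x powr s n)))"

definition step_sizes :: "real \<Rightarrow> real set" where
  "step_sizes T = {h. \<exists>M::nat. h = T / real M} \<inter> {0<..1}"

definition brownian_increment ::
    "(real \<Rightarrow> 'a \<Rightarrow> real) \<Rightarrow> real \<Rightarrow> nat \<Rightarrow> 'a \<Rightarrow> real" where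
  "brownian_increment W h n \<omega> = W (real (Suc n) * h) \<omega> - W (real n * h) \<omega>"

definition mu_hat :: "(real \<Rightarrow> real) \<Rightarrow> real \<Rightarrow> real \<Rightarrow> real" where
  "mu_hat \<mu> c x = \<mu> x - c / x"

text \<open>The recursion along one path; \<open>c\<close> is the coefficient of the implicitly treated term,
  \<open>P\<close> the projection for the step size \<open>h\<close> and \<open>dW n\<close> the \<open>n\<close>-th increment of the path.\<close>

definition projected_semi_implicit_scheme ::
    "(real \<Rightarrow> real) \<Rightarrow> real \<Rightarrow> real \<Rightarrow> (real \<Rightarrow> real) \<Rightarrow> real \<Rightarrow> (nat \<Rightarrow> real) \<Rightarrow> (nat \<Rightarrow> real) \<Rightarrow> bool"
  where
  "projected_semi_implicit_scheme \<mu> c \<sigma> P h dW Y \<longleftrightarrow>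
     (\<forall>n. Y (Suc n) = P (Y n) + c * h / Y (Suc n) + mu_hat \<mu> c (P (Y n)) * h + \<sigma> * dW n)"

end

theory Submission
  imports Defs
begin

text \<open>Along a fixed path, everything in one step except the implicit term is a known real
  number \<open>b\<close>, so the new value \<open>y\<close> must solve y = b + k / y with k = c * h
  > 0. For y > 0 this is the quadratic y^2 - b * y - k = 0. Its roots have product -k < 0, so
  exactly one of them is positive, whatever the sign of \<open>b\<close>
  (\<open>positive_implicit_step_iff\<close>). Unique solvability of each step then gives a unique
  positive sequence (\<open>ex1_recursive_sequence\<close>).\<close>

lemma positive_implicit_step_iff:
  fixes b k y :: real
  assumes "k > 0"
  shows "y > 0 \<and> y = b + k / y \<longleftrightarrow> y = (b + sqrt (b\<^sup>2 + 4 * k)) / 2"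
proof -
  define r where "r = sqrt (b\<^sup>2 + 4 * k)"
  have r2: "r\<^sup>2 = b\<^sup>2 + 4 * k"
    using assms by (simp add: r_def)
  \<comment> \<open>This strict bound separates the signs of the roots: (b + r) / 2 > 0 > (b - r) /
    2.\<close>
  have r: "r > \<bar>b\<bar>"
    unfolding r_def using assms by (intro real_less_rsqrt) simp
  have eq: "y = b + k / y \<longleftrightarrow> (2 * y - b)\<^sup>2 = r\<^sup>2" if "y > 0"
  proof -
    have "y = b + k / y \<longleftrightarrow> y * y = b * y + k"
      using that by (simp add: field_simps)
    also have "\<dots> \<longleftrightarrow> (2 * y - b)\<^sup>2 = r\<^sup>2"
      unfolding r2 by (auto simp: algebra_simps power2_eq_square)
    finally show ?thesis .
  qed
  have "y > 0 \<and> (2 * y - b)\<^sup>2 = r\<^sup>2 \<longleftrightarrow> y = (b + r) / 2"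
    using r by (auto simp: power2_eq_iff)
  with eq show ?thesis
    unfolding r_def by blast
qed

text \<open>Existence is dependent choice, uniqueness is induction on the index. Membership in
  \<open>A\<close> is carried along because a step is solvable, and its solution unique, only within
  \<open>A\<close>.\<close>

lemma ex1_recursive_sequence:
  fixes R :: "nat \<Rightarrow> 'a \<Rightarrow> 'a \<Rightarrow> bool"
  assumes "x0 \<in> A" and step: "\<And>n x. x \<in> A \<Longrightarrow> \<exists>!y. y \<in> A \<and> R n x y"
  shows "\<exists>!Y. Y 0 = x0 \<and> (\<forall>n. Y n \<in> A) \<and> (\<forall>n. R n (Y n) (Y (Suc n)))"
proof (rule ex_ex1I)
  show "\<exists>Y. Y 0 = x0 \<and> (\<forall>n. Y n \<in> A) \<and> (\<forall>n. R n (Y n) (Y (Suc n)))"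
    \<comment> \<open>The implication in the invariant pins the start value, which dependent choice
      alone leaves open.\<close>
    using dependent_nat_choice[of "\<lambda>n x. x \<in> A \<and> (n = 0 \<longrightarrow> x = x0)" R] assms by blast
next
  fix Y Z
  assume Y: "Y 0 = x0 \<and> (\<forall>n. Y n \<in> A) \<and> (\<forall>n. R n (Y n) (Y (Suc n)))"
    and Z: "Z 0 = x0 \<and> (\<forall>n. Z n \<in> A) \<and> (\<forall>n. R n (Z n) (Z (Suc n)))"
  have "Y n = Z n" for n
  proof (induction n)
    case 0
    show ?case using Y Z by simp
  next
    case (Suc n)
    then show ?case using step[of "Y n" n] Y Z by metis
  qed
  then show "Y = Z" ..
qed

theorem lemma3p6:
  fixes \<Omega> :: "'a measure" and W :: "real \<Rightarrow> 'a \<Rightarrow> real"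
    and \<mu> :: "real \<Rightarrow> real" and \<sigma> T c :: real
    and P :: "real \<Rightarrow> real \<Rightarrow> real"
    and X0 h :: real
  assumes "standard_brownian_motion \<Omega> W"
    and "fractional_laurent_poly \<mu>"
    and "\<sigma> \<noteq> 0" and "T > 0" and "c > 0"
    and "\<And>k x. k \<in> step_sizes T \<Longrightarrow> x > 0 \<Longrightarrow> P k x > 0"
    and "X0 > 0" and "h \<in> step_sizes T"
  shows "\<forall>\<omega>\<in>space \<Omega>. \<exists>!Y :: nat \<Rightarrow> real.
           Y 0 = X0 \<and> (\<forall>n. Y n > 0) \<and>
           projected_semi_implicit_scheme \<mu> c \<sigma> (P h) h (\<lambda>n. brownian_increment W h n \<omega>) Y"
proof
  fix \<omega>
  \<comment> \<open>Since T / 0 = 0, the case of zero steps is excluded by the interval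
    \<open>{0<..1}\<close> in \<open>step_sizes\<close>.\<close>
  have k: "c * h > 0"
    using assms by (simp add: step_sizes_def)
  \<comment> \<open>\<open>b n y\<close> collects the explicit part of step \<open>n\<close>: it
    depends on the current value and the path, not on the new value.\<close>
  define b where "b n y = P h y + mu_hat \<mu> c (P h y) * h + \<sigma> * brownian_increment W h n \<omega>" for n y
  have "\<exists>!y. y \<in> {0<..} \<and> y = b n x + c * h / y" for n x
    unfolding greaterThan_iff positive_implicit_step_iff[OF k] by blast
  from ex1_recursive_sequence[of X0 "{0<..}" "\<lambda>n x y. y = b n x + c * h / y", OF _ this]
  show "\<exists>!Y :: nat \<Rightarrow> real.
           Y 0 = X0 \<and> (\<forall>n. Y n > 0) \<and>
           projected_semi_implicit_scheme \<mu> c \<sigma> (P h) h (\<lambda>n. brownian_increment W h n \<omega>) Y"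
    using \<open>X0 > 0\<close> by (simp add: projected_semi_implicit_scheme_def b_def algebra_simps)
qed

end
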